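(* There exists an absolute polynomial $C=C(m,n)$ such that the following holds. Let $\boldsymbol{A}\in\mathbb{R}^{m\times n}$ have full column rank. Consider a (possibly randomized) floating-point subroutine $\mathrm{Solver}$ satisfying $$\mathbb{E}\,\|\mathrm{Solver}(\boldsymbol{b})-\boldsymbol{A}^+\boldsymbol{b}\|\le q\,\|\boldsymbol{A}^+\boldsymbol{b}\|$$ for some $q$ and all inputs $\boldsymbol{b}$. If $(1+Cu)q<1/2$, $C\tilde\kappa(\boldsymbol{A})u<3/4$, and $\boldsymbol{b}\in\mathrm{Range}(\boldsymbol{A})$, then the iterative refinement scheme $$\boldsymbol{x}_0:=\mathrm{Solver}(\boldsymbol{b}),\qquad \boldsymbol{x}_{i+1}:=\boldsymbol{x}_i+\mathrm{Solver}(\boldsymbol{b}-\boldsymbol{A}\boldsymbol{x}_i),\quad i=0,1,\dots,t-1,$$ executed in floating-point arithmetic with unit roundoff $u$, produces a computed solution $\widehat{\boldsymbol{x}}_t$ satisfying $$\mathbb{E}\,\|\widehat{\boldsymbol{x}}_t-\boldsymbol{A}^+\boldsymbol{b}\|\le\left(C\tilde\kappa(\boldsymbol{A})u+(1+Cu)^tq^{t+1}\right)\|\boldsymbol{A}^+\boldsymbol{b}\|.$$ Consequently, forward stability is achieved in expectation in $t=\log_2\!\left(\frac{1}{\tilde\kappa(\boldsymbol{A})u}\right)$ refinements (rounded up to an integer), in the sense that $$\mathbb{E}\,\|\widehat{\boldsymbol{x}}_t-\boldsymbol{A}^+\boldsymbol{b}\|\lesssim\tilde\kappa(\boldsymbo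l{A})u\,\|\boldsymbol{A}^+\boldsymbol{b}\|.$$
   Context: $\boldsymbol{A}^+$ is the Moore–Penrose pseudoinverse. $\|\cdot\|$ is the vector $\ell_2$ norm and its induced operator norm; $\|\cdot\|_{\rm F}$ is the Frobenius norm. For $\boldsymbol{A}$ of full column rank the Demmel condition number is $\tilde\kappa(\boldsymbol{A})=\|\boldsymbol{A}\|_{\rm F}\|\boldsymbol{A}^+\|$. Here $a\lesssim b$ means $a\le C'b$ for a fixed universal polynomial $C'=C'(m,n)>0$ of the dimensions. Each call to $\mathrm{Solver}$ uses fresh randomness, independent of its input and of previous calls; expectations are over all this randomness. The residual $\boldsymbol{b}-\boldsymbol{A}\boldsymbol{x}_i$ and the update $\boldsymbol{x}_i+\mathrm{Solver}(\cdot)$ are evaluated in floating-point arithmetic of the same precision $u$; $\widehat{\boldsymbol{x}}_t$ is the computed value of $\boldsymbol{x}_t$. Floating-point model (standard model, unit roundoff $u$, no overflow/underflow): the rounding function $\mathrm{fl}$ satisfies $|\mathrm{fl}(x)-x|\le u|x|$ for all $x\in\mathbb{R}$, and for exactly represented scalars $a,b$ and $\mathrm{op}\in\{+,-,\times,\div\}$ the computed value of $a\,\mathrm{op}\,b$ differs from $a\,\mathrm{op}\,b$ by at most $u\,|a\,\mathrm{op}\,b|$. Vector operations and matrix–vector products are computed by the standard routines from these scalar operations. The entries of $\boldsymbol{A}$ and $\boldsymbol{b}$ are exactly represented. *)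

theory Defs
  imports "HOL-Probability.Giry_Monad" "Jordan_Normal_Form.DL_Rank"
begin

no_notation Finite_Cartesian_Product.vec_nth (infixl "$" 90)
notation Matrix.vec_index (infixl "$" 100)

section \<open>Linear algebra over the reals\<close>

definition vnorm :: "real Matrix.vec \<Rightarrow> real" where
  "vnorm x = sqrt (\<Sum>i<dim_vec x. (x $ i)\<^sup>2)"

definition op_norm :: "real Matrix.mat \<Rightarrow> real" where
  "op_norm A = Sup {vnorm (A *\<^sub>v x) | x. x \<in> carrier_vec (dim_col A) \<and> vnorm x \<le> 1}"

definition frob_norm :: "real Matrix.mat \<Rightarrow> real" where
  "frob_norm A = sqrt (\<Sum>i<dim_row A. \<Sum>j<dim_col A. (A $$ (i, j))\<^sup>2)"

text \<open>The four Penrose conditions.\<close>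

definition is_pinv :: "real Matrix.mat \<Rightarrow> real Matrix.mat \<Rightarrow> bool" where
  "is_pinv A X \<longleftrightarrow>
     X \<in> carrier_mat (dim_col A) (dim_row A) \<and>
     A * X * A = A \<and> X * A * X = X \<and>
     transpose_mat (A * X) = A * X \<and> transpose_mat (X * A) = X * A"

definition pinv :: "real Matrix.mat \<Rightarrow> real Matrix.mat" where
  "pinv A = (THE X. is_pinv A X)"

definition full_column_rank :: "real Matrix.mat \<Rightarrow> bool" where
  "full_column_rank A \<longleftrightarrow> vec_space.rank (dim_row A) A = dim_col A"

definition mat_range :: "real Matrix.mat \<Rightarrow> real Matrix.vec set" where
  "mat_range A = {A *\<^sub>v x | x. x \<in> carrier_vec (dim_col A)}"

definition demmel_cond :: "real Matrix.mat \<Rightarrow> real" where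
  "demmel_cond A = frob_norm A * op_norm (pinv A)"

text \<open>Functions of the two dimensions that are real polynomials.\<close>

definition dim_polynomial :: "(nat \<Rightarrow> nat \<Rightarrow> real) \<Rightarrow> bool" where
  "dim_polynomial C \<longleftrightarrow> (\<exists>(d::nat) (c :: nat \<Rightarrow> nat \<Rightarrow> real). \<forall>m n.
     C m n = (\<Sum>i\<le>d. \<Sum>j\<le>d. c i j * real m ^ i * real n ^ j))"

section \<open>Floating-point arithmetic\<close>

datatype arith_op = Add | Sub | Mul | Div

fun exact_op :: "arith_op \<Rightarrow> real \<Rightarrow> real \<Rightarrow> real" where
  "exact_op Add a b = a + b"
| "exact_op Sub a b = a - b"
| "exact_op Mul a b = a * b"
| "exact_op Div a b = a / b"

text \<open>
  \<open>F\<close> is the set of exactly represented reals, \<open>fl\<close> the rounding function, and \<open>fop p a b\<close> the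
  computed value of \<open>a p b\<close>. The computed value need not be \<open>fl\<close> of the exact one; only the error
  bound is required. Assumption \<open>fop_measurable\<close> is there so that expectations of computed
  quantities make sense. It holds automatically if \<open>F\<close> is countable, as it is for any concrete
  floating-point format, since \<open>F\<close> then carries the discrete \<open>\<sigma>\<close>-algebra.
\<close>

locale standard_fp_model =
  fixes u :: real
    and F :: "real set"
    and fl :: "real \<Rightarrow> real"
    and fop :: "arith_op \<Rightarrow> real \<Rightarrow> real \<Rightarrow> real"
  assumes u_pos: "0 < u"
    and fl_repr: "fl x \<in> F"
    and fl_error: "\<bar>fl x - x\<bar> \<le> u * \<bar>x\<bar>"
    and fop_repr:
      "a \<in> F \<Longrightarrow> b \<in> F \<Longrightarrow> (p = Div \<longrightarrow> b \<noteq> 0) \<Longrightarrow> fop p a b \<in> F"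
    and fop_error:
      "a \<in> F \<Longrightarrow> b \<in> F \<Longrightarrow> (p = Div \<longrightarrow> b \<noteq> 0) \<Longrightarrow>
         \<bar>fop p a b - exact_op p a b\<bar> \<le> u * \<bar>exact_op p a b\<bar>"
    and fop_measurable:
      "(\<lambda>(a, b). fop p a b) \<in> restrict_space borel F \<Otimes>\<^sub>M restrict_space borel F \<rightarrow>\<^sub>M borel"

definition fp_vecs :: "real set \<Rightarrow> nat \<Rightarrow> real Matrix.vec set" where
  "fp_vecs F k = {v \<in> carrier_vec k. \<forall>i<k. v $ i \<in> F}"

text \<open>Summation proceeds from left to right, starting with the first term.\<close>

fun fp_sum :: "(arith_op \<Rightarrow> real \<Rightarrow> real \<Rightarrow> real) \<Rightarrow> real list \<Rightarrow> real" where
  "fp_sum fop [] = 0"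
| "fp_sum fop (x # xs) = foldl (fop Add) x xs"

definition fp_mult_mat_vec ::
  "(arith_op \<Rightarrow> real \<Rightarrow> real \<Rightarrow> real) \<Rightarrow> real Matrix.mat \<Rightarrow> real Matrix.vec \<Rightarrow> real Matrix.vec" where
  "fp_mult_mat_vec fop A x = Matrix.vec (dim_row A)
     (\<lambda>i. fp_sum fop (map (\<lambda>j. fop Mul (A $$ (i, j)) (x $ j)) [0..<dim_col A]))"

definition fp_vec_op ::
  "(arith_op \<Rightarrow> real \<Rightarrow> real \<Rightarrow> real) \<Rightarrow> arith_op \<Rightarrow>
     real Matrix.vec \<Rightarrow> real Matrix.vec \<Rightarrow> real Matrix.vec" where
  "fp_vec_op fop p x y = Matrix.vec (dim_vec x) (\<lambda>i. fop p (x $ i) (y $ i))"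

definition fp_residual ::
  "(arith_op \<Rightarrow> real \<Rightarrow> real \<Rightarrow> real) \<Rightarrow> real Matrix.mat \<Rightarrow> real Matrix.vec \<Rightarrow>
     real Matrix.vec \<Rightarrow> real Matrix.vec" where
  "fp_residual fop A b x = fp_vec_op fop Sub b (fp_mult_mat_vec fop A x)"

section \<open>Randomized subroutines and iterative refinement\<close>

text \<open>The Borel space of floating-point vectors of length \<open>k\<close>.\<close>

definition fp_space :: "real set \<Rightarrow> nat \<Rightarrow> real Matrix.vec measure" where
  "fp_space F k = vimage_algebra (fp_vecs F k) (\<lambda>v. \<lambda>i\<in>{..<k}. v $ i) (\<Pi>\<^sub>M i\<in>{..<k}. borel)"

text \<open>
  A randomized floating-point subroutine is given by the law of its output for each input, i.e. by
  a Markov kernel. Point masses give deterministic subroutines. Measurability in the input is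
  automatic when \<open>F\<close> is countable.
\<close>

definition randomized_subroutine ::
  "real set \<Rightarrow> nat \<Rightarrow> nat \<Rightarrow> (real Matrix.vec \<Rightarrow> real Matrix.vec measure) \<Rightarrow> bool" where
  "randomized_subroutine F m n S \<longleftrightarrow> S \<in> fp_space F m \<rightarrow>\<^sub>M prob_algebra (fp_space F n)"

text \<open>
  \<open>refinement_law F fop A b S i\<close> is the law of the computed \<open>i\<close>-th iterate. Monadic composition
  draws, given the current iterate \<open>x\<close>, a new output \<open>d\<close> of the solver from the law determined
  by the computed residual alone; this is what using fresh, independent randomness in each call
  means.
\<close>

primrec refinement_law ::
  "real set \<Rightarrow> (arith_op \<Rightarrow> real \<Rightarrow> real \<Rightarrow> real) \<Rightarrow> real Matrix.mat \<Rightarrow> real Matrix.vec \<Rightarrow>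
     (real Matrix.vec \<Rightarrow> real Matrix.vec measure) \<Rightarrow> nat \<Rightarrow> real Matrix.vec measure" where
  "refinement_law F fop A b S 0 = S b"
| "refinement_law F fop A b S (Suc i) =
     refinement_law F fop A b S i \<bind>
       (\<lambda>x. distr (S (fp_residual fop A b x)) (fp_space F (dim_col A))
              (\<lambda>d. fp_vec_op fop Add x d))"

text \<open>
  Integrability is part of the bound, since the Bochner integral of a non-integrable function is 0.
\<close>

definition expectation_le :: "'a measure \<Rightarrow> ('a \<Rightarrow> real) \<Rightarrow> real \<Rightarrow> bool" where
  "expectation_le M f c \<longleftrightarrow> integrable M f \<and> (\<integral>x. f x \<partial>M) \<le> c"

end

theory Submission
  imports Defs
begin

text \<open>
  Write \<open>x\<close> for the solution, \<open>A *\<^sub>v x = b\<close>, and \<open>\<kappa>\<close> for the Demmel condition number. One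
  refinement step from an iterate \<open>y\<close> commits three errors. The computed residual \<open>r\<close> differs from
  \<open>A *\<^sub>v (x - y)\<close> by rounding, and applying the pseudoinverse turns this difference into at most
  \<open>5 n \<kappa> u (\<parallel>y - x\<parallel> + \<parallel>x\<parallel>)\<close> (\<open>pinv_fp_residual_error\<close>): the Frobenius norm of \<open>A\<close> enters through
  the rounding of the matrix-vector product, the operator norm of the pseudoinverse through solving.
  The solver adds an error of expectation at most \<open>q \<parallel>pinv A *\<^sub>v r\<parallel>\<close>. Finally, rounding the update
  multiplies what has accumulated by \<open>1 + u\<close> and adds \<open>u \<parallel>x\<parallel>\<close>. Because each call of the solver
  sees the past only through \<open>y\<close>, integrating over the call and then over \<open>y\<close> gives an affine
  recursion \<open>E\<^sub>i\<^sub>+\<^sub>1 \<le> \<alpha> E\<^sub>i + \<beta> \<parallel>x\<parallel>\<close> for the expected errors (\<open>refinement_kernel_error\<close>,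
  \<open>expectation_le_bind\<close>), where \<open>\<alpha> = (1 + u) q + O(n \<kappa> u)\<close> and \<open>\<beta> = O(n \<kappa> u)\<close>.

  The contraction factor contains a term of order \<open>\<kappa> u\<close>, whereas the asserted transient
  \<open>(1 + C u)\<^sup>t q\<^sup>t\<^sup>+\<^sup>1\<close> contracts by \<open>(1 + C u) q\<close> only. The surplus is harmless: it multiplies
  an error that is itself bounded, hence costs \<open>O(n \<kappa> u)\<close> per step and can be charged to the
  stationary part \<open>C \<kappa> u\<close>. There is room for it, since the contraction carries over at most half
  of that part and \<open>C\<close> is a large enough multiple of \<open>n + 1\<close> (\<open>error_recursion_stable\<close>). After
  \<open>\<lceil>log 2 (1 / (\<kappa> u))\<rceil>\<close> steps the transient is at most \<open>\<kappa> u\<close>, because \<open>(1 + C u) q < 1 / 2\<close>.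

  The two sign conditions that the recursion needs come from full column rank: \<open>\<kappa> \<ge> 1\<close>, and
  \<open>q \<ge> 0\<close>, as the first column of \<open>A\<close> is a representable right-hand side with a nonzero solution.
  Both need \<open>n > 0\<close>; for \<open>n = 0\<close> all errors vanish.
\<close>

section \<open>Euclidean, operator and Frobenius norms\<close>

lemma vnorm_L2_set: "vnorm x = L2_set (\<lambda>i. x $ i) {..<dim_vec x}"
  by (simp add: vnorm_def L2_set_def)

lemma vnorm_nonneg [simp]: "0 \<le> vnorm x"
  by (simp add: vnorm_L2_set)

lemma vnorm_zero_vec [simp]: "vnorm (0\<^sub>v k) = 0"
  by (simp add: vnorm_def)

text \<open>
  Rounding errors are known entry by entry as multiples of other vectors' entries; this passes from
  such bounds to norms. The triangle inequality and the monotonicity of the norm are special cases.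
\<close>

lemma vnorm_le_combination:
  assumes "x \<in> carrier_vec k" "y \<in> carrier_vec k" "z \<in> carrier_vec k"
    and "0 \<le> \<alpha>" "0 \<le> \<beta>"
    and bound: "\<And>i. i < k \<Longrightarrow> \<bar>x $ i\<bar> \<le> \<alpha> * \<bar>y $ i\<bar> + \<beta> * \<bar>z $ i\<bar>"
  shows "vnorm x \<le> \<alpha> * vnorm y + \<beta> * vnorm z"
proof -
  have "vnorm x = L2_set (\<lambda>i. \<bar>x $ i\<bar>) {..<k}"
    using assms by (simp add: vnorm_L2_set L2_set_def)
  also have "\<dots> \<le> L2_set (\<lambda>i. \<alpha> * \<bar>y $ i\<bar> + \<beta> * \<bar>z $ i\<bar>) {..<k}"
    by (rule L2_set_mono) (use bound in auto)
  also have "\<dots> \<le> L2_set (\<lambda>i. \<alpha> * \<bar>y $ i\<bar>) {..<k} + L2_set (\<lambda>i. \<beta> * \<bar>z $ i\<bar>) {..<k}"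
    by (rule L2_set_triangle_ineq)
  also have "\<dots> = \<alpha> * L2_set (\<lambda>i. \<bar>y $ i\<bar>) {..<k} + \<beta> * L2_set (\<lambda>i. \<bar>z $ i\<bar>) {..<k}"
    using assms by (simp add: L2_set_right_distrib)
  also have "\<dots> = \<alpha> * vnorm y + \<beta> * vnorm z"
    using assms by (simp add: vnorm_L2_set L2_set_def)
  finally show ?thesis .
qed

lemma vnorm_add_le:
  assumes "x \<in> carrier_vec k" "y \<in> carrier_vec k"
  shows "vnorm (x + y) \<le> vnorm x + vnorm y"
  using vnorm_le_combination[of "x + y" k x y 1 1] assms by (simp add: abs_triangle_ineq)

lemma vnorm_smult: "vnorm (c \<cdot>\<^sub>v x) = \<bar>c\<bar> * vnorm x"
  by (simp add: vnorm_def power_mult_distrib real_sqrt_mult flip: sum_distrib_left)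

lemma vnorm_minus_commute:
  assumes "x \<in> carrier_vec k" "y \<in> carrier_vec k"
  shows "vnorm (x - y) = vnorm (y - x)"
  using assms by (simp add: vnorm_def power2_commute)

lemma vnorm_unit_vec:
  assumes "j < n"
  shows "vnorm (unit_vec n j) = 1"
proof -
  have "(\<Sum>i<n. ((unit_vec n j :: real Matrix.vec) $ i)\<^sup>2) = (\<Sum>i<n. if i = j then 1 else 0)"
    using assms by (intro sum.cong) auto
  then show ?thesis
    using assms by (simp add: vnorm_def)
qed

lemma frob_norm_nonneg [simp]: "0 \<le> frob_norm A"
  by (simp add: frob_norm_def sum_nonneg)

text \<open>
  The bound is stated for any vector dominated by \<open>\<bar>A\<bar> \<bar>x\<bar>\<close>, not just for \<open>A *\<^sub>v x\<close>, because the
  rounding error of a matrix-vector product has size \<open>\<bar>A\<bar> \<bar>x\<bar>\<close>, without any cancellation. This is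
  where the Frobenius norm is needed: the operator norm of \<open>\<bar>A\<bar>\<close> may exceed that of \<open>A\<close>, but taking
  absolute values preserves the Frobenius norm.
\<close>

lemma vnorm_le_frob_norm:
  assumes A: "A \<in> carrier_mat m n" and x: "x \<in> carrier_vec n" and y: "y \<in> carrier_vec m"
    and bound: "\<And>i. i < m \<Longrightarrow> \<bar>y $ i\<bar> \<le> (\<Sum>j<n. \<bar>A $$ (i, j)\<bar> * \<bar>x $ j\<bar>)"
  shows "vnorm y \<le> frob_norm A * vnorm x"
proof -
  let ?row = "\<lambda>i. L2_set (\<lambda>j. A $$ (i, j)) {..<n}"
  have frob: "frob_norm A = L2_set ?row {..<m}"
    using A by (simp add: frob_norm_def L2_set_def sum_nonneg)
  have "vnorm y = L2_set (\<lambda>i. \<bar>y $ i\<bar>) {..<m}"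
    using y by (simp add: vnorm_L2_set L2_set_def)
  also have "\<dots> \<le> L2_set (\<lambda>i. ?row i * vnorm x) {..<m}"
  proof (rule L2_set_mono)
    fix i assume "i \<in> {..<m}"
    then have "\<bar>y $ i\<bar> \<le> (\<Sum>j<n. \<bar>A $$ (i, j)\<bar> * \<bar>x $ j\<bar>)"
      using bound by simp
    also have "\<dots> \<le> ?row i * vnorm x"
      using L2_set_mult_ineq[of "\<lambda>j. A $$ (i, j)" "\<lambda>j. x $ j" "{..<n}"] x
      by (simp add: vnorm_L2_set)
    finally show "\<bar>y $ i\<bar> \<le> ?row i * vnorm x" .
  qed simp
  also have "\<dots> = frob_norm A * vnorm x"
    by (simp add: frob L2_set_left_distrib)
  finally show ?thesis .
qed

lemma vnorm_mult_mat_vec_le_frob: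
  assumes A: "A \<in> carrier_mat m n" and x: "x \<in> carrier_vec n"
  shows "vnorm (A *\<^sub>v x) \<le> frob_norm A * vnorm x"
proof (rule vnorm_le_frob_norm[OF A x])
  fix i assume "i < m"
  then have "(A *\<^sub>v x) $ i = (\<Sum>j<n. A $$ (i, j) * x $ j)"
    using A x by (simp add: scalar_prod_def lessThan_atLeast0)
  then show "\<bar>(A *\<^sub>v x) $ i\<bar> \<le> (\<Sum>j<n. \<bar>A $$ (i, j)\<bar> * \<bar>x $ j\<bar>)"
    by (simp add: order_trans[OF sum_abs] abs_mult)
qed (use A x in simp)

lemma op_norm_upper:
  assumes A: "A \<in> carrier_mat m n" and x: "x \<in> carrier_vec n" and "vnorm x \<le> 1"
  shows "vnorm (A *\<^sub>v x) \<le> op_norm A"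
  unfolding op_norm_def
proof (rule cSup_upper)
  show "bdd_above {vnorm (A *\<^sub>v x) |x. x \<in> carrier_vec (dim_col A) \<and> vnorm x \<le> 1}"
  proof (rule bdd_aboveI)
    fix r assume "r \<in> {vnorm (A *\<^sub>v x) |x. x \<in> carrier_vec (dim_col A) \<and> vnorm x \<le> 1}"
    then obtain z where z: "r = vnorm (A *\<^sub>v z)" "z \<in> carrier_vec n" "vnorm z \<le> 1"
      using A by auto
    have "r \<le> frob_norm A * vnorm z"
      using vnorm_mult_mat_vec_le_frob[OF A] z by simp
    also have "\<dots> \<le> frob_norm A"
      using z mult_left_mono[of "vnorm z" 1 "frob_norm A"] by simp
    finally show "r \<le> frob_norm A" .
  qed
qed (use assms in auto)

lemma op_norm_nonneg: "0 \<le> op_norm A"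
  using op_norm_upper[of A "dim_row A" "dim_col A" "0\<^sub>v (dim_col A)"]
  by (auto intro: order_trans[OF vnorm_nonneg])

lemma vnorm_mult_mat_vec_le:
  assumes A: "A \<in> carrier_mat m n" and x: "x \<in> carrier_vec n"
  shows "vnorm (A *\<^sub>v x) \<le> op_norm A * vnorm x"
proof (cases "vnorm x = 0")
  case True
  then show ?thesis
    using vnorm_mult_mat_vec_le_frob[OF A x] by simp
next
  case False
  then have pos: "0 < vnorm x"
    using vnorm_nonneg[of x] by linarith
  have "vnorm (A *\<^sub>v (inverse (vnorm x) \<cdot>\<^sub>v x)) \<le> op_norm A"
    using x pos by (intro op_norm_upper[OF A]) (auto simp: vnorm_smult)
  then have "inverse (vnorm x) * vnorm (A *\<^sub>v x) \<le> op_norm A"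
    using A x pos by (simp add: mult_mat_vec vnorm_smult)
  then show ?thesis
    using pos by (simp add: field_simps)
qed

section \<open>The pseudoinverse of a matrix of full column rank\<close>

text \<open>
  Penrose's argument: \<open>A X\<close> and \<open>A Y\<close> are symmetric idempotents with the same range, so they
  coincide, as do \<open>X A\<close> and \<open>Y A\<close>; then \<open>X = X A X = X A Y = Y A Y = Y\<close>.
\<close>

lemma is_pinv_unique:
  assumes X: "is_pinv A X" and Y: "is_pinv A Y"
  shows "X = Y"
proof -
  define m where "m = dim_row A"
  define n where "n = dim_col A"
  have A: "A \<in> carrier_mat m n"
    by (auto simp: m_def n_def)
  have cX: "X \<in> carrier_mat n m" and cY: "Y \<in> carrier_mat n m"
    using X Y by (auto simp: is_pinv_def m_def n_def)
  note [simp] = A cX cY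
  have AX: "A * X * A = A" "X * A * X = X" "(A * X)\<^sup>T = A * X" "(X * A)\<^sup>T = X * A"
    using X by (auto simp: is_pinv_def)
  have AY: "A * Y * A = A" "Y * A * Y = Y" "(A * Y)\<^sup>T = A * Y" "(Y * A)\<^sup>T = Y * A"
    using Y by (auto simp: is_pinv_def)
  have "A * X = A * Y * A * X"
    using AY by simp
  also have "\<dots> = (A * Y) * (A * X)"
    by (rule assoc_mult_mat[of _ m m _ n _ m]) (auto intro!: mult_carrier_mat[of _ m n] )
  also have "\<dots> = (A * Y)\<^sup>T * (A * X)\<^sup>T"
    using AX AY by simp
  also have "\<dots> = ((A * X) * (A * Y))\<^sup>T"
    by (rule transpose_mult[symmetric, of _ m m _ m]) (auto intro!: mult_carrier_mat[of _ m n])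
  also have "(A * X) * (A * Y) = (A * X * A) * Y"
    by (rule assoc_mult_mat[symmetric, of _ m m _ n _ m]) (auto intro!: mult_carrier_mat[of _ m n])
  also have "(A * X * A * Y)\<^sup>T = A * Y"
    using AX AY by simp
  finally have range_proj: "A * X = A * Y" .
  have "X * A = X * (A * Y * A)"
    using AY by simp
  also have "A * Y * A = A * (Y * A)"
    by (rule assoc_mult_mat[of _ m n _ m _ n]) auto
  also have "X * (A * (Y * A)) = (X * A) * (Y * A)"
    by (rule assoc_mult_mat[symmetric, of _ n m _ n _ n]) (auto intro!: mult_carrier_mat[of _ n m])
  also have "\<dots> = (X * A)\<^sup>T * (Y * A)\<^sup>T"
    using AX AY by simp
  also have "\<dots> = ((Y * A) * (X * A))\<^sup>T"
    by (rule transpose_mult[symmetric, of _ n n _ n]) (auto intro!: mult_carrier_mat[of _ n m])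
  also have "(Y * A) * (X * A) = Y * (A * (X * A))"
    by (rule assoc_mult_mat[of _ n m _ n _ n]) (auto intro!: mult_carrier_mat[of _ n m])
  also have "A * (X * A) = A * X * A"
    by (rule assoc_mult_mat[symmetric, of _ m n _ m _ n]) auto
  also have "(Y * (A * X * A))\<^sup>T = Y * A"
    using AX AY by simp
  finally have corange_proj: "X * A = Y * A" .
  have "X = X * A * X"
    using AX by simp
  also have "\<dots> = X * (A * X)"
    by (rule assoc_mult_mat[of _ n m _ n _ m]) auto
  also have "\<dots> = X * (A * Y)"
    by (simp only: range_proj)
  also have "\<dots> = X * A * Y"
    by (rule assoc_mult_mat[symmetric, of _ n m _ n _ m]) auto
  also have "\<dots> = Y"
    using corange_proj AY by simp
  finally show ?thesis .
qed

text \<open>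
  The rank is the dimension of the span of the set of columns. If it equals the number of columns,
  then the columns are pairwise distinct and that set is independent.
\<close>

lemma full_column_rank_inj:
  assumes A: "A \<in> carrier_mat m n" and rank: "full_column_rank A"
    and x: "x \<in> carrier_vec n" and Ax: "A *\<^sub>v x = 0\<^sub>v m"
  shows "x = 0\<^sub>v n"
proof (rule ccontr)
  assume "x \<noteq> 0\<^sub>v n"
  interpret vec_space "TYPE(real)" m .
  have rank: "rank A = n"
    using rank A by (simp add: full_column_rank_def)
  obtain S where S: "maximal S (\<lambda>T. T \<subseteq> set (cols A) \<and> lin_indpt T)"
    using maximal_exists_superset[of "set (cols A)" "\<lambda>T. T \<subseteq> set (cols A) \<and> lin_indpt T" "{}"]
      finite_lin_indpt2[of "{}"] by auto
  then have "n \<le> card (set (cols A))"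
    using rank_card_indpt[OF A S] rank by (auto simp: maximal_def intro: card_mono)
  then have "distinct (cols A)"
    using A card_length[of "cols A"] by (intro card_distinct) simp
  then show False
    using full_rank_lin_indpt[OF A rank] lin_depI[OF A x \<open>x \<noteq> 0\<^sub>v n\<close> Ax] by blast
qed

text \<open>
  The pseudoinverse is \<open>(A\<^sup>T A)\<^sup>-\<^sup>1 A\<^sup>T\<close>. The Gram matrix is invertible, since
  \<open>A\<^sup>T A v = 0\<close> gives \<open>\<parallel>A v\<parallel>\<^sup>2 = 0\<close> and hence \<open>v = 0\<close>.
\<close>

lemma full_column_rank_is_pinv:
  assumes A: "A \<in> carrier_mat m n" and rank: "full_column_rank A"
  obtains X where "is_pinv A X" "X \<in> carrier_mat n m" "X * A = 1\<^sub>m n"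
proof -
  let ?G = "A\<^sup>T * A"
  have G: "?G \<in> carrier_mat n n"
    using A by simp
  have "Determinant.det ?G \<noteq> 0"
  proof
    assume "Determinant.det ?G = 0"
    then obtain v where v: "v \<in> carrier_vec n" "v \<noteq> 0\<^sub>v n" "?G *\<^sub>v v = 0\<^sub>v n"
      using det_0_iff_vec_prod_zero_field[OF G] by auto
    have Av: "A *\<^sub>v v \<in> carrier_vec m"
      using A v by simp
    have "0 = Matrix.scalar_prod v (?G *\<^sub>v v)"
      using v by simp
    also have "\<dots> = Matrix.scalar_prod (A\<^sup>T *\<^sub>v (A *\<^sub>v v)) v"
      using A v Av comm_scalar_prod[of v n "A\<^sup>T *\<^sub>v (A *\<^sub>v v)"]
      by (simp add: assoc_mult_mat_vec[of _ n m _ n])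
    also have "\<dots> = Matrix.scalar_prod (A *\<^sub>v v) (A *\<^sub>v v)"
      by (rule transpose_vec_mult_scalar[OF A v(1) Av])
    also have "\<dots> = (\<Sum>i<m. ((A *\<^sub>v v) $ i)\<^sup>2)"
      using A by (simp add: scalar_prod_def power2_eq_square lessThan_atLeast0)
    finally have "\<forall>i<m. (A *\<^sub>v v) $ i = 0"
      by (simp add: sum_nonneg_eq_0_iff)
    then have "A *\<^sub>v v = 0\<^sub>v m"
      using A by (intro eq_vecI) auto
    then show False
      using full_column_rank_inj[OF A rank v(1)] v(2) by simp
  qed
  then obtain H where H: "H \<in> carrier_mat n n" "H * ?G = 1\<^sub>m n"  "?G * H = 1\<^sub>m n"
    using det_non_zero_imp_unit[OF G] by (auto simp: Units_def ring_mat_def)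
  have HT: "H\<^sup>T = H"
  proof -
    \<comment> \<open>The inverse of a symmetric matrix is symmetric, since its transpose is a right inverse too.\<close>
    have "?G\<^sup>T = ?G"
      using A by (simp add: transpose_mult[of _ n m])
    then have "?G * H\<^sup>T = 1\<^sub>m n"
      using H G by (metis transpose_mult transpose_one)
    then have "H = H * (?G * H\<^sup>T)"
      using H by simp
    also have "\<dots> = H\<^sup>T"
      using H G assoc_mult_mat[of H n n ?G n "H\<^sup>T" n] by simp
    finally show ?thesis by simp
  qed
  define X where "X = H * A\<^sup>T"
  have X: "X \<in> carrier_mat n m"
    using H A by (simp add: X_def)
  have XA: "X * A = 1\<^sub>m n"
    using H A by (simp add: X_def assoc_mult_mat[of H n n _ m _ n])
  have "A * X * A = A"
    using A X XA by (simp add: assoc_mult_mat[of A m n X m A n])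
  moreover have "X * A * X = X"
    using X XA by simp
  moreover have "(X * A)\<^sup>T = X * A"
    using XA by simp
  moreover have "(A * X)\<^sup>T = A * X"
  proof -
    have "(A * X)\<^sup>T = (H * A\<^sup>T)\<^sup>T * A\<^sup>T"
      using A X by (simp add: transpose_mult[of A m n] X_def)
    also have "(H * A\<^sup>T)\<^sup>T = A * H"
      using A H HT by (simp add: transpose_mult[of H n n _ m])
    also have "A * H * A\<^sup>T = A * X"
      using A H by (simp add: X_def assoc_mult_mat[of A m n H n _ m])
    finally show ?thesis .
  qed
  ultimately have "is_pinv A X"
    using X A by (simp add: is_pinv_def)
  then show ?thesis
    using X XA that by blast
qed

lemma pinv_full_column_rank:
  assumes A: "A \<in> carrier_mat m n" and rank: "full_column_rank A"
  shows "pinv A \<in> carrier_mat n m" "pinv A * A = 1\<^sub>m n"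
proof -
  obtain X where X: "is_pinv A X" "X \<in> carrier_mat n m" "X * A = 1\<^sub>m n"
    using full_column_rank_is_pinv[OF A rank] .
  then have "pinv A = X"
    unfolding pinv_def by (blast intro: is_pinv_unique)
  with X show "pinv A \<in> carrier_mat n m" "pinv A * A = 1\<^sub>m n"
    by auto
qed

lemma pinv_mult_mat_vec:
  assumes A: "A \<in> carrier_mat m n" and rank: "full_column_rank A" and x: "x \<in> carrier_vec n"
  shows "pinv A *\<^sub>v (A *\<^sub>v x) = x"
  using assoc_mult_mat_vec[OF pinv_full_column_rank(1)[OF A rank] A x]
    pinv_full_column_rank(2)[OF A rank] x by simp

lemma pinv_mult_col:
  assumes A: "A \<in> carrier_mat m n" and rank: "full_column_rank A" and j: "j < n"
  shows "pinv A *\<^sub>v col A j = unit_vec n j"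
proof -
  have "A *\<^sub>v unit_vec n j = col A j"
    using A j by (intro eq_vecI) auto
  then show ?thesis
    using pinv_mult_mat_vec[OF A rank, of "unit_vec n j"] by simp
qed

text \<open>
  A unit vector \<open>e\<close> is recovered from \<open>A *\<^sub>v e\<close>, so its norm \<open>1\<close> is at most that of the
  pseudoinverse times \<open>\<parallel>A e\<parallel> \<le> frob_norm A\<close>.
\<close>

lemma demmel_cond_ge_1:
  assumes A: "A \<in> carrier_mat m n" and rank: "full_column_rank A" and "0 < n"
  shows "1 \<le> demmel_cond A"
proof -
  define e :: "real Matrix.vec" where "e = unit_vec n 0"
  have e: "e \<in> carrier_vec n"
    by (simp add: e_def)
  have "(\<Sum>i<n. (e $ i)\<^sup>2) = (\<Sum>i<n. if i = 0 then 1 else 0)"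
    by (intro sum.cong) (auto simp: e_def)
  then have e1: "vnorm e = 1"
    using e \<open>0 < n\<close> by (simp add: vnorm_def)
  have "1 = vnorm (pinv A *\<^sub>v (A *\<^sub>v e))"
    using pinv_mult_mat_vec[OF A rank e] e1 by simp
  also have "\<dots> \<le> op_norm (pinv A) * vnorm (A *\<^sub>v e)"
    using vnorm_mult_mat_vec_le[OF pinv_full_column_rank(1)[OF A rank]] A e by simp
  also have "\<dots> \<le> op_norm (pinv A) * frob_norm A"
    using vnorm_mult_mat_vec_le_frob[OF A e] e1 by (intro mult_left_mono op_norm_nonneg) simp
  finally show ?thesis
    by (simp add: demmel_cond_def mult.commute)
qed

section \<open>Rounding errors of one refinement step\<close>

lemma fp_vecs_carrier: "v \<in> fp_vecs F k \<Longrightarrow> v \<in> carrier_vec k"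
  by (simp add: fp_vecs_def)

lemma fp_vecs_index: "v \<in> fp_vecs F k \<Longrightarrow> i < k \<Longrightarrow> v $ i \<in> F"
  by (simp add: fp_vecs_def)

lemma elements_mat_subset_index:
  assumes "elements_mat A \<subseteq> F" "A \<in> carrier_mat m n" "i < m" "j < n"
  shows "A $$ (i, j) \<in> F"
  using assms by (auto simp: elements_mat_def image_subset_iff UN_subset_iff)

text \<open>
  Turns the accumulated factor of \<open>n\<close> successive roundings into a multiple of \<open>n u\<close>.
\<close>

lemma one_add_power_le:
  fixes u :: real
  assumes "0 \<le> u" "real n * u \<le> 1"
  shows "(1 + u) ^ n - 1 \<le> 2 * real n * u"
proof -
  have "(1 + u) ^ n \<le> exp u ^ n"
    using assms exp_ge_add_one_self[of u] by (intro power_mono) auto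
  also have "\<dots> = exp (real n * u)"
    by (simp add: exp_of_nat_mult)
  also have "\<dots> \<le> 1 + real n * u + (real n * u)\<^sup>2"
    using assms by (intro exp_bound) auto
  also have "(real n * u)\<^sup>2 \<le> real n * u"
    using assms mult_left_mono[of "real n * u" 1 "real n * u"] by (simp add: power2_eq_square)
  finally show ?thesis
    by (simp add: algebra_simps)
qed

context standard_fp_model
begin

lemma zero_repr: "0 \<in> F"
  using fl_repr[of 0] fl_error[of 0] by simp

lemma fop_add_repr: "a \<in> F \<Longrightarrow> b \<in> F \<Longrightarrow> fop Add a b \<in> F"
  and fop_sub_repr: "a \<in> F \<Longrightarrow> b \<in> F \<Longrightarrow> fop Sub a b \<in> F"
  and fop_mul_repr: "a \<in> F \<Longrightarrow> b \<in> F \<Longrightarrow> fop Mul a b \<in> F"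
  using fop_repr by auto

lemma fop_add_error: "a \<in> F \<Longrightarrow> b \<in> F \<Longrightarrow> \<bar>fop Add a b - (a + b)\<bar> \<le> u * \<bar>a + b\<bar>"
  and fop_sub_error: "a \<in> F \<Longrightarrow> b \<in> F \<Longrightarrow> \<bar>fop Sub a b - (a - b)\<bar> \<le> u * \<bar>a - b\<bar>"
  and fop_mul_error: "a \<in> F \<Longrightarrow> b \<in> F \<Longrightarrow> \<bar>fop Mul a b - a * b\<bar> \<le> u * \<bar>a * b\<bar>"
  using fop_error[of a b Add] fop_error[of a b Sub] fop_error[of a b Mul] by auto

lemma foldl_add_repr: "set xs \<subseteq> F \<Longrightarrow> s \<in> F \<Longrightarrow> foldl (fop Add) s xs \<in> F"
  by (induction xs arbitrary: s) (auto simp: fop_add_repr)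

lemma fp_sum_repr: "set xs \<subseteq> F \<Longrightarrow> fp_sum fop xs \<in> F"
  by (cases xs) (auto simp: zero_repr foldl_add_repr)

text \<open>
  Every term passes through at most \<open>length xs\<close> roundings, each of relative size \<open>u\<close>. The partial
  sum \<open>s\<close> counts as a term, which keeps the statement inductive.
\<close>

lemma foldl_add_error:
  assumes "set xs \<subseteq> F" "s \<in> F"
  shows "\<bar>foldl (fop Add) s xs - (s + sum_list xs)\<bar>
    \<le> ((1 + u) ^ length xs - 1) * (\<bar>s\<bar> + sum_list (map abs xs))"
  using assms
proof (induction xs arbitrary: s)
  case Nil
  then show ?case by simp
next
  case (Cons x xs)
  define s' where "s' = fop Add s x"
  define \<gamma> where "\<gamma> = (1 + u) ^ length xs - 1"
  define S where "S = sum_list (map abs xs)"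
  have x: "x \<in> F" and xs: "set xs \<subseteq> F"
    using Cons.prems by auto
  have s': "s' \<in> F"
    unfolding s'_def using Cons.prems x by (simp add: fop_add_repr)
  have step: "\<bar>s' - (s + x)\<bar> \<le> u * \<bar>s + x\<bar>"
    unfolding s'_def using Cons.prems x by (simp add: fop_add_error)
  then have s'_le: "\<bar>s'\<bar> \<le> (1 + u) * \<bar>s + x\<bar>"
    by (simp add: algebra_simps)
  have \<gamma>: "0 \<le> \<gamma>"
    using u_pos by (simp add: \<gamma>_def)
  have S: "0 \<le> S"
    unfolding S_def by (rule sum_list_nonneg) auto
  have "\<bar>foldl (fop Add) s' xs - (s' + sum_list xs)\<bar> \<le> \<gamma> * (\<bar>s'\<bar> + S)"
    using Cons.IH[OF xs s'] by (simp add: \<gamma>_def S_def)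
  \<comment> \<open>With \<open>1 + \<gamma>' = (1 + u) (1 + \<gamma>)\<close> for one more rounding, the bound below is at most \<open>\<gamma>' (\<bar>s + x\<bar> + S)\<close>.\<close>
  then have "\<bar>foldl (fop Add) s' xs - (s + x + sum_list xs)\<bar> \<le> \<gamma> * (\<bar>s'\<bar> + S) + u * \<bar>s + x\<bar>"
    using step by linarith
  also have "\<dots> \<le> \<gamma> * ((1 + u) * \<bar>s + x\<bar> + S) + u * \<bar>s + x\<bar>"
    using s'_le \<gamma> by (simp add: mult_left_mono)
  also have "\<dots> = ((1 + u) * (1 + \<gamma>) - 1) * \<bar>s + x\<bar> + \<gamma> * S"
    by (simp add: algebra_simps)
  also have "\<dots> \<le> ((1 + u) * (1 + \<gamma>) - 1) * \<bar>s + x\<bar> + ((1 + u) * (1 + \<gamma>) - 1) * S"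
    using \<gamma> S u_pos by (intro add_left_mono mult_right_mono) (auto simp: algebra_simps)
  also have "\<dots> = ((1 + u) * (1 + \<gamma>) - 1) * (\<bar>s + x\<bar> + S)"
    by (simp add: algebra_simps)
  also have "\<dots> \<le> ((1 + u) * (1 + \<gamma>) - 1) * (\<bar>s\<bar> + (\<bar>x\<bar> + S))"
    using \<gamma> u_pos by (intro mult_left_mono) (auto simp: algebra_simps)
  finally show ?case
    by (simp add: s'_def \<gamma>_def S_def add.assoc)
qed

lemma fp_sum_error:
  assumes "set xs \<subseteq> F"
  shows "\<bar>fp_sum fop xs - sum_list xs\<bar>
    \<le> ((1 + u) ^ (length xs - 1) - 1) * sum_list (map abs xs)"
  using foldl_add_error[of "tl xs" "hd xs"] assms by (cases xs) auto

text \<open>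
  The products contribute one rounding per term and the summation, which starts with the first
  product, \<open>n - 1\<close> more.
\<close>

lemma fp_dot_error:
  fixes a x :: "nat \<Rightarrow> real"
  assumes a: "\<And>j. j < n \<Longrightarrow> a j \<in> F" and x: "\<And>j. j < n \<Longrightarrow> x j \<in> F"
  shows "\<bar>fp_sum fop (map (\<lambda>j. fop Mul (a j) (x j)) [0..<n]) - (\<Sum>j<n. a j * x j)\<bar>
    \<le> ((1 + u) ^ n - 1) * (\<Sum>j<n. \<bar>a j\<bar> * \<bar>x j\<bar>)"
proof (cases "n = 0")
  case True
  then show ?thesis by simp
next
  case False
  define p where "p j = fop Mul (a j) (x j)" for j
  define S where "S = (\<Sum>j<n. \<bar>a j\<bar> * \<bar>x j\<bar>)"
  \<comment> \<open>The exponent is meant for \<open>n > 0\<close>, where \<open>(1 + u) (1 + \<gamma>) = (1 + u) ^ n\<close>.\<close>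
  define \<gamma> where "\<gamma> = (1 + u) ^ (n - 1) - 1"
  have \<gamma>: "0 \<le> \<gamma>"
    using u_pos by (simp add: \<gamma>_def)
  have p: "\<bar>p j - a j * x j\<bar> \<le> u * (\<bar>a j\<bar> * \<bar>x j\<bar>)" if "j < n" for j
    using fop_mul_error[OF a[OF that] x[OF that]] by (simp add: p_def abs_mult)
  have "\<bar>p j\<bar> \<le> (1 + u) * (\<bar>a j\<bar> * \<bar>x j\<bar>)" if "j < n" for j
    using p[OF that] abs_mult[of "a j" "x j"] by (simp add: distrib_right) linarith
  then have abs_p: "(\<Sum>j<n. \<bar>p j\<bar>) \<le> (1 + u) * S"
    unfolding S_def sum_distrib_left by (intro sum_mono) auto
  have "\<bar>(\<Sum>j<n. p j) - (\<Sum>j<n. a j * x j)\<bar> \<le> (\<Sum>j<n. \<bar>p j - a j * x j\<bar>)"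
    unfolding sum_subtractf[symmetric] by (rule sum_abs)
  also have "\<dots> \<le> u * S"
    unfolding S_def sum_distrib_left using p by (intro sum_mono) auto
  finally have products: "\<bar>(\<Sum>j<n. p j) - (\<Sum>j<n. a j * x j)\<bar> \<le> u * S" .
  have "\<bar>fp_sum fop (map p [0..<n]) - (\<Sum>j<n. p j)\<bar> \<le> \<gamma> * (\<Sum>j<n. \<bar>p j\<bar>)"
    using fp_sum_error[of "map p [0..<n]"] a x
    by (force simp: \<gamma>_def p_def fop_mul_repr sum_list_sum_nth lessThan_atLeast0)
  also have "\<dots> \<le> \<gamma> * ((1 + u) * S)"
    using abs_p \<gamma> by (rule mult_left_mono)
  finally have "\<bar>fp_sum fop (map p [0..<n]) - (\<Sum>j<n. a j * x j)\<bar> \<le> \<gamma> * ((1 + u) * S) + u * S"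
    using products by linarith
  also have "\<dots> = ((1 + u) * (1 + \<gamma>) - 1) * S"
    by (simp add: algebra_simps)
  also have "(1 + u) * (1 + \<gamma>) = (1 + u) ^ n"
    using False by (cases n) (auto simp: \<gamma>_def)
  finally show ?thesis
    by (simp add: p_def S_def)
qed

lemma fp_mult_mat_vec_fp_vecs:
  assumes "A \<in> carrier_mat m n" "elements_mat A \<subseteq> F" "x \<in> fp_vecs F n"
  shows "fp_mult_mat_vec fop A x \<in> fp_vecs F m"
  using assms
  by (auto simp: fp_vecs_def fp_mult_mat_vec_def
      intro!: fp_sum_repr fop_mul_repr elements_mat_subset_index)

lemma fp_residual_fp_vecs:
  assumes "A \<in> carrier_mat m n" "elements_mat A \<subseteq> F" "b \<in> fp_vecs F m" "x \<in> fp_vecs F n"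
  shows "fp_residual fop A b x \<in> fp_vecs F m"
  using fp_mult_mat_vec_fp_vecs[OF assms(1,2,4)] assms(3)
  by (auto simp: fp_vecs_def fp_residual_def fp_vec_op_def intro!: fop_sub_repr)

lemma fp_add_fp_vecs:
  assumes "x \<in> fp_vecs F n" "d \<in> fp_vecs F n"
  shows "fp_vec_op fop Add x d \<in> fp_vecs F n"
  using assms by (auto simp: fp_vecs_def fp_vec_op_def intro!: fop_add_repr)

lemma fp_residual_error:
  assumes A: "A \<in> carrier_mat m n" "elements_mat A \<subseteq> F"
    and b: "b \<in> fp_vecs F m" and x: "x \<in> fp_vecs F n"
  shows "vnorm (fp_residual fop A b x - (b - A *\<^sub>v x))
    \<le> u * vnorm (b - A *\<^sub>v x) + (1 + u) * ((1 + u) ^ n - 1) * (frob_norm A * vnorm x)"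
proof -
  define r where "r = fp_residual fop A b x"
  \<comment> \<open>The vector \<open>\<bar>A\<bar> \<bar>x\<bar>\<close>, by which the rounding errors of the product are measured.\<close>
  define w where "w = Matrix.vec m (\<lambda>i. \<Sum>j<n. \<bar>A $$ (i, j)\<bar> * \<bar>x $ j\<bar>)"
  define \<gamma> where "\<gamma> = (1 + u) ^ n - 1"
  have \<gamma>: "0 \<le> \<gamma>"
    using u_pos by (simp add: \<gamma>_def)
  have cx: "x \<in> carrier_vec n" and cb: "b \<in> carrier_vec m"
    using x b by (auto simp: fp_vecs_carrier)
  have r: "r \<in> carrier_vec m"
    using fp_residual_fp_vecs[OF A b x] by (simp add: r_def fp_vecs_carrier)
  have "vnorm (r - (b - A *\<^sub>v x)) \<le> u * vnorm (b - A *\<^sub>v x) + (1 + u) * \<gamma> * vnorm w"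
  proof (rule vnorm_le_combination)
    fix i assume i: "i < m"
    let ?y = "fp_sum fop (map (\<lambda>j. fop Mul (A $$ (i, j)) (x $ j)) [0..<n])"
    have Ax: "(A *\<^sub>v x) $ i = (\<Sum>j<n. A $$ (i, j) * x $ j)"
      using A cx i by (simp add: scalar_prod_def lessThan_atLeast0)
    have y: "\<bar>?y - (A *\<^sub>v x) $ i\<bar> \<le> \<gamma> * w $ i"
      using fp_dot_error[of n "\<lambda>j. A $$ (i, j)" "\<lambda>j. x $ j"] i x A
      by (simp add: Ax w_def \<gamma>_def fp_vecs_index elements_mat_subset_index)
    have "?y \<in> F"
      using fp_vecs_index[OF fp_mult_mat_vec_fp_vecs[OF A x] i] A i
      by (simp add: fp_mult_mat_vec_def)
    moreover have "r $ i = fop Sub (b $ i) ?y"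
      using A i cb by (simp add: r_def fp_residual_def fp_vec_op_def fp_mult_mat_vec_def)
    ultimately have "\<bar>r $ i - (b $ i - ?y)\<bar> \<le> u * \<bar>b $ i - ?y\<bar>"
      using fop_sub_error fp_vecs_index[OF b i] by simp
    also have "\<dots> \<le> u * (\<bar>b $ i - (A *\<^sub>v x) $ i\<bar> + \<gamma> * w $ i)"
      using y u_pos by (intro mult_left_mono) linarith+
    finally have "\<bar>r $ i - (b $ i - (A *\<^sub>v x) $ i)\<bar>
        \<le> u * \<bar>b $ i - (A *\<^sub>v x) $ i\<bar> + (1 + u) * (\<gamma> * w $ i)"
      using y by (simp add: algebra_simps)
    also have "w $ i = \<bar>w $ i\<bar>"
      using i by (simp add: w_def sum_nonneg)
    finally show "\<bar>(r - (b - A *\<^sub>v x)) $ i\<bar>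
        \<le> u * \<bar>(b - A *\<^sub>v x) $ i\<bar> + (1 + u) * \<gamma> * \<bar>w $ i\<bar>"
      using i A cb cx by (simp add: mult.assoc)
  qed (use r cb A cx u_pos \<gamma> in \<open>auto simp: w_def\<close>)
  also have "vnorm w \<le> frob_norm A * vnorm x"
    by (rule vnorm_le_frob_norm[OF A(1) cx]) (auto simp: w_def sum_nonneg)
  finally show ?thesis
    using \<gamma> u_pos by (simp add: r_def \<gamma>_def mult_left_mono)
qed

text \<open>
  The ideal correction is \<open>x - y\<close>; this bounds how far the exact solution for the computed residual
  is from it. The bound is proportional to the condition number, because the pseudoinverse is applied
  to an error whose size is governed by \<open>A\<close>. Since the rounding errors are relative to the computed
  iterate, the error bound involves \<open>\<parallel>y\<parallel> \<le> \<parallel>y - x\<parallel> + \<parallel>x\<parallel>\<close>, so it does not vanish even at \<open>y = x\<close>: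
  this is what limits the attainable accuracy.
\<close>

lemma pinv_fp_residual_error:
  assumes A: "A \<in> carrier_mat m n" "elements_mat A \<subseteq> F" "full_column_rank A"
    and x: "x \<in> carrier_vec n" and b: "A *\<^sub>v x \<in> fp_vecs F m"
    and y: "y \<in> fp_vecs F n" and n: "0 < n" and nu: "real n * u \<le> 1"
  shows "vnorm (pinv A *\<^sub>v fp_residual fop A (A *\<^sub>v x) y - (x - y))
    \<le> 5 * real n * demmel_cond A * u * (vnorm (y - x) + vnorm x)"
proof -
  let ?b = "A *\<^sub>v x" and ?r = "fp_residual fop A (A *\<^sub>v x) y"
  define \<gamma> where "\<gamma> = (1 + u) ^ n - 1"
  have \<gamma>: "0 \<le> \<gamma>" "\<gamma> \<le> 2 * real n * u"
    using u_pos nu one_add_power_le[of u n] by (auto simp: \<gamma>_def)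
  have u1: "u \<le> real n * u" "u \<le> 1"
    using n nu u_pos mult_right_mono[of 1 "real n" u] by linarith+
  have cy: "y \<in> carrier_vec n" and r: "?r \<in> carrier_vec m"
    using y fp_residual_fp_vecs[OF A(1,2) b y] by (auto simp: fp_vecs_carrier)
  note P = pinv_full_column_rank(1)[OF A(1,3)]
  have diff: "?b - A *\<^sub>v y = A *\<^sub>v (x - y)"
    using A x cy by (simp add: mult_minus_distrib_mat_vec)
  have "pinv A *\<^sub>v ?r - (x - y) = pinv A *\<^sub>v ?r - pinv A *\<^sub>v (A *\<^sub>v (x - y))"
    using pinv_mult_mat_vec[OF A(1,3), of "x - y"] x cy by simp
  also have "\<dots> = pinv A *\<^sub>v (?r - (?b - A *\<^sub>v y))"
    unfolding diff
    by (rule mult_minus_distrib_mat_vec[symmetric, of _ n m]) (use P r A x cy in auto)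
  finally have "pinv A *\<^sub>v ?r - (x - y) = pinv A *\<^sub>v (?r - (?b - A *\<^sub>v y))" .
  then have pinv_le: "vnorm (pinv A *\<^sub>v ?r - (x - y)) \<le> op_norm (pinv A) * vnorm (?r - (?b - A *\<^sub>v y))"
    using vnorm_mult_mat_vec_le[OF P, of "?r - (?b - A *\<^sub>v y)"] r A x cy by simp
  define s where "s = vnorm (y - x) + vnorm x"
  have "y = (y - x) + x"
    using x cy by auto
  then have y_le: "vnorm y \<le> s"
    using vnorm_add_le[of "y - x" n x] x cy by (simp add: s_def)
  have s: "0 \<le> s" "vnorm (y - x) \<le> s"
    by (auto simp: s_def)
  have "vnorm (?b - A *\<^sub>v y) \<le> frob_norm A * vnorm (y - x)"
    unfolding diff using vnorm_mult_mat_vec_le_frob[OF A(1), of "x - y"] x cy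
    by (simp add: vnorm_minus_commute[of x n])
  also have "\<dots> \<le> frob_norm A * s"
    using s by (simp add: mult_left_mono)
  finally have diff_le: "vnorm (?b - A *\<^sub>v y) \<le> frob_norm A * s" .
  have "vnorm (?r - (?b - A *\<^sub>v y))
      \<le> u * vnorm (?b - A *\<^sub>v y) + (1 + u) * \<gamma> * (frob_norm A * vnorm y)"
    unfolding \<gamma>_def by (rule fp_residual_error[OF A(1,2) b y])
  \<comment> \<open>The residual subtraction contributes \<open>u \<le> n u\<close>, the product \<open>(1 + u) \<gamma> \<le> 2 (2 n u)\<close>.\<close>
  also have "\<dots> \<le> real n * u * (frob_norm A * s) + 2 * (2 * real n * u) * (frob_norm A * s)"
    using u1 \<gamma> u_pos diff_le y_le by (intro add_mono mult_mono) auto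
  also have "\<dots> = 5 * real n * u * (frob_norm A * s)"
    by (simp add: algebra_simps)
  finally have "op_norm (pinv A) * vnorm (?r - (?b - A *\<^sub>v y))
      \<le> op_norm (pinv A) * (5 * real n * u * (frob_norm A * s))"
    by (intro mult_left_mono op_norm_nonneg)
  also have "\<dots> = 5 * real n * demmel_cond A * u * s"
    by (simp add: demmel_cond_def)
  finally show ?thesis
    using pinv_le by (simp add: s_def)
qed

lemma refinement_step_error:
  assumes A: "A \<in> carrier_mat m n" "elements_mat A \<subseteq> F" "full_column_rank A"
    and x: "x \<in> carrier_vec n" and b: "A *\<^sub>v x \<in> fp_vecs F m"
    and y: "y \<in> fp_vecs F n" and d: "d \<in> fp_vecs F n"
  shows "vnorm (fp_vec_op fop Add y d - x)
    \<le> (1 + u) * vnorm (d - pinv A *\<^sub>v fp_residual fop A (A *\<^sub>v x) y)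
      + ((1 + u) * vnorm (pinv A *\<^sub>v fp_residual fop A (A *\<^sub>v x) y - (x - y)) + u * vnorm x)"
proof -
  define z where "z = pinv A *\<^sub>v fp_residual fop A (A *\<^sub>v x) y"
  have cy: "y \<in> carrier_vec n" and cd: "d \<in> carrier_vec n"
    using y d by (auto simp: fp_vecs_carrier)
  have z: "z \<in> carrier_vec n"
    unfolding z_def using pinv_full_column_rank(1)[OF A(1,3)] fp_residual_fp_vecs[OF A(1,2) b y]
    by (auto simp: fp_vecs_carrier)
  have "vnorm (fp_vec_op fop Add y d - x) \<le> (1 + u) * vnorm (y + d - x) + u * vnorm x"
  proof (rule vnorm_le_combination[of _ n])
    fix i assume i: "i < n"
    have "\<bar>fop Add (y $ i) (d $ i) - (y $ i + d $ i)\<bar> \<le> u * \<bar>y $ i + d $ i\<bar>"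
      by (rule fop_add_error) (use y d i in \<open>auto simp: fp_vecs_index\<close>)
    also have "\<dots> \<le> u * (\<bar>y $ i + d $ i - x $ i\<bar> + \<bar>x $ i\<bar>)"
      using u_pos by (intro mult_left_mono) linarith+
    finally have "\<bar>fop Add (y $ i) (d $ i) - x $ i\<bar>
        \<le> (1 + u) * \<bar>y $ i + d $ i - x $ i\<bar> + u * \<bar>x $ i\<bar>"
      by (simp add: algebra_simps)
    then show "\<bar>(fp_vec_op fop Add y d - x) $ i\<bar>
        \<le> (1 + u) * \<bar>(y + d - x) $ i\<bar> + u * \<bar>x $ i\<bar>"
      using i cy cd x by (simp add: fp_vec_op_def)
  qed (use x cy cd u_pos in \<open>auto simp: fp_vec_op_def\<close>)
  also have "(1 + u) * vnorm (y + d - x) \<le> (1 + u) * (vnorm (d - z) + vnorm (z - (x - y)))"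
  proof (rule mult_left_mono)
    have "y + d - x = (d - z) + (z - (x - y))"
      by (rule eq_vecI) (use x cy cd z in auto)
    then show "vnorm (y + d - x) \<le> vnorm (d - z) + vnorm (z - (x - y))"
      using vnorm_add_le[of "d - z" n "z - (x - y)"] x cy cd z by simp
  qed (use u_pos in simp)
  finally show ?thesis
    by (simp add: z_def algebra_simps)
qed

end

section \<open>Measurability of the floating-point routines\<close>

lemma space_fp_space [simp]: "space (fp_space F k) = fp_vecs F k"
  by (simp add: fp_space_def)

lemma measurable_fp_space_index:
  assumes "i < k"
  shows "(\<lambda>v. v $ i) \<in> fp_space F k \<rightarrow>\<^sub>M restrict_space borel F"
proof (rule measurable_restrict_space2)
  have "(\<lambda>v. \<lambda>i\<in>{..<k}. v $ i) \<in> fp_space F k \<rightarrow>\<^sub>M (\<Pi>\<^sub>M i\<in>{..<k}. borel)"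
    unfolding fp_space_def by (rule measurable_vimage_algebra1) (auto simp: space_PiM)
  moreover have "(\<lambda>f. f i) \<in> (\<Pi>\<^sub>M i\<in>{..<k}. borel) \<rightarrow>\<^sub>M borel"
    using assms by (intro measurable_component_singleton) simp
  ultimately have "(\<lambda>v. (\<lambda>i\<in>{..<k}. v $ i) i) \<in> fp_space F k \<rightarrow>\<^sub>M borel"
    by (rule measurable_compose)
  then show "(\<lambda>v. v $ i) \<in> fp_space F k \<rightarrow>\<^sub>M borel"
    using assms by simp
qed (use assms in \<open>auto simp: fp_vecs_index\<close>)

text \<open>
  Together with the measurability of the coordinates, this reduces measurability of vector-valued
  maps to that of scalar ones. The codomain of the coordinates is \<open>F\<close> rather than the real line, since
  computed operations are only constrained on representable arguments.
\<close>

lemma measurable_fp_spaceI: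
  assumes "\<And>w. w \<in> space N \<Longrightarrow> f w \<in> carrier_vec k"
    and "\<And>i. i < k \<Longrightarrow> (\<lambda>w. f w $ i) \<in> N \<rightarrow>\<^sub>M restrict_space borel F"
  shows "f \<in> N \<rightarrow>\<^sub>M fp_space F k"
  unfolding fp_space_def
proof (rule measurable_vimage_algebra2)
  show "f \<in> space N \<rightarrow> fp_vecs F k"
    using assms measurable_space[OF assms(2)] by (fastforce simp: fp_vecs_def space_restrict_space)
  show "(\<lambda>w. \<lambda>i\<in>{..<k}. f w $ i) \<in> N \<rightarrow>\<^sub>M (\<Pi>\<^sub>M i\<in>{..<k}. borel)"
    using assms(2) by (intro measurable_restrict) (auto dest: measurable_restrict_space2_iff[THEN iffD1])
qed

lemma measurable_fp_space_vnorm_diff: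
  assumes "x \<in> carrier_vec k"
  shows "(\<lambda>v. vnorm (v - x)) \<in> borel_measurable (fp_space F k)"
proof -
  have [measurable]: "(\<lambda>v. v $ i) \<in> borel_measurable (fp_space F k)" if "i < k" for i
    using measurable_fp_space_index[OF that] by (simp add: measurable_restrict_space2_iff)
  have "(\<lambda>v. sqrt (\<Sum>i<k. (v $ i - x $ i)\<^sup>2)) \<in> borel_measurable (fp_space F k)"
    by measurable
  then show ?thesis
    using assms by (simp add: vnorm_def cong: measurable_cong)
qed

context standard_fp_model
begin

lemma fop_measurable_repr:
  assumes f: "f \<in> N \<rightarrow>\<^sub>M restrict_space borel F" and g: "g \<in> N \<rightarrow>\<^sub>M restrict_space borel F"
    and "p \<noteq> Div"
  shows "(\<lambda>w. fop p (f w) (g w)) \<in> N \<rightarrow>\<^sub>M restrict_space borel F"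
proof (rule measurable_restrict_space2)
  show "(\<lambda>w. fop p (f w) (g w)) \<in> space N \<rightarrow> F"
    using measurable_space[OF f] measurable_space[OF g] fop_repr \<open>p \<noteq> Div\<close>
    by (auto simp: space_restrict_space)
  show "(\<lambda>w. fop p (f w) (g w)) \<in> N \<rightarrow>\<^sub>M borel"
    using measurable_compose[OF measurable_Pair[OF f g] fop_measurable[of p]] by simp
qed

lemma foldl_add_measurable:
  assumes "\<And>h. h \<in> set hs \<Longrightarrow> h \<in> N \<rightarrow>\<^sub>M restrict_space borel F"
    and "g \<in> N \<rightarrow>\<^sub>M restrict_space borel F"
  shows "(\<lambda>w. foldl (fop Add) (g w) (map (\<lambda>h. h w) hs)) \<in> N \<rightarrow>\<^sub>M restrict_space borel F"
  using assms
proof (induction hs arbitrary: g)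
  case (Cons h hs)
  then show ?case
    using Cons.IH[of "\<lambda>w. fop Add (g w) (h w)"] by (simp add: fop_measurable_repr)
qed simp

lemma fp_sum_measurable:
  assumes "\<And>h. h \<in> set hs \<Longrightarrow> h \<in> N \<rightarrow>\<^sub>M restrict_space borel F"
  shows "(\<lambda>w. fp_sum fop (map (\<lambda>h. h w) hs)) \<in> N \<rightarrow>\<^sub>M restrict_space borel F"
  using assms foldl_add_measurable[of "tl hs" N "hd hs"] zero_repr
  by (cases hs) (auto simp: space_restrict_space)

lemma fp_residual_measurable:
  assumes A: "A \<in> carrier_mat m n" "elements_mat A \<subseteq> F" and b: "b \<in> fp_vecs F m"
  shows "fp_residual fop A b \<in> fp_space F n \<rightarrow>\<^sub>M fp_space F m"
proof (rule measurable_fp_spaceI)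
  fix i assume i: "i < m"
  have "(\<lambda>x. fp_sum fop (map (\<lambda>h. h x) (map (\<lambda>j x. fop Mul (A $$ (i, j)) (x $ j)) [0..<n])))
      \<in> fp_space F n \<rightarrow>\<^sub>M restrict_space borel F"
    by (rule fp_sum_measurable)
      (use A i in \<open>auto intro!: fop_measurable_repr measurable_fp_space_index
        simp: space_restrict_space elements_mat_subset_index\<close>)
  then have "(\<lambda>x. fop Sub (b $ i) (fp_sum fop (map (\<lambda>j. fop Mul (A $$ (i, j)) (x $ j)) [0..<n])))
      \<in> fp_space F n \<rightarrow>\<^sub>M restrict_space borel F"
    using fp_vecs_index[OF b i]
    by (intro fop_measurable_repr) (auto simp: space_restrict_space comp_def)
  then show "(\<lambda>x. fp_residual fop A b x $ i) \<in> fp_space F n \<rightarrow>\<^sub>M restrict_space borel F"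
    using A i fp_vecs_carrier[OF b]
    by (simp add: fp_residual_def fp_vec_op_def fp_mult_mat_vec_def)
qed (use A b in \<open>auto dest: fp_residual_fp_vecs intro: fp_vecs_carrier\<close>)

lemma fp_add_measurable:
  "(\<lambda>(x, d). fp_vec_op fop Add x d) \<in> fp_space F n \<Otimes>\<^sub>M fp_space F n \<rightarrow>\<^sub>M fp_space F n"
proof (rule measurable_fp_spaceI)
  fix i assume i: "i < n"
  have "(\<lambda>w. fop Add (fst w $ i) (snd w $ i))
      \<in> fp_space F n \<Otimes>\<^sub>M fp_space F n \<rightarrow>\<^sub>M restrict_space borel F"
    by (intro fop_measurable_repr measurable_compose[OF measurable_fst]
        measurable_compose[OF measurable_snd] measurable_fp_space_index[OF i]) simp
  then show "(\<lambda>w. (case w of (x, d) \<Rightarrow> fp_vec_op fop Add x d) $ i)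
      \<in> fp_space F n \<Otimes>\<^sub>M fp_space F n \<rightarrow>\<^sub>M restrict_space borel F"
    by (rule measurable_cong[THEN iffD1, rotated])
      (use i in \<open>auto simp: space_pair_measure fp_vec_op_def dest: fp_vecs_carrier\<close>)
qed (auto simp: space_pair_measure dest: fp_add_fp_vecs fp_vecs_carrier)

text \<open>
  The update map must be measurable in the iterate and the correction jointly, since the iterate
  enters both the law of the correction and the map that pushes it forward.
\<close>

lemma refinement_kernel_measurable:
  assumes A: "A \<in> carrier_mat m n" "elements_mat A \<subseteq> F" and b: "b \<in> fp_vecs F m"
    and S: "randomized_subroutine F m n S"
  shows "(\<lambda>x. distr (S (fp_residual fop A b x)) (fp_space F n) (fp_vec_op fop Add x))
    \<in> fp_space F n \<rightarrow>\<^sub>M prob_algebra (fp_space F n)"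
proof (rule measurable_distr_prob_space2)
  show "(\<lambda>x. S (fp_residual fop A b x)) \<in> fp_space F n \<rightarrow>\<^sub>M prob_algebra (fp_space F n)"
    using S fp_residual_measurable[OF A b]
    by (auto simp: randomized_subroutine_def intro: measurable_compose)
qed (use fp_add_measurable in simp)

lemma refinement_law_space:
  assumes A: "A \<in> carrier_mat m n" "elements_mat A \<subseteq> F" and b: "b \<in> fp_vecs F m"
    and S: "randomized_subroutine F m n S"
  shows "refinement_law F fop A b S t \<in> space (prob_algebra (fp_space F n))"
proof (induction t)
  case 0
  then show ?case
    using measurable_space[OF S[unfolded randomized_subroutine_def]] b by simp
next
  case (Suc t)
  then have "(\<lambda>_. refinement_law F fop A b S t) \<in> count_space UNIV \<rightarrow>\<^sub>M prob_algebra (fp_space F n)"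
    by simp
  from measurable_space[OF measurable_bind_prob_space[OF this refinement_kernel_measurable[OF A b S]], of undefined]
  show ?case
    using A(1) by simp
qed

end

section \<open>Bounds on expectations\<close>

lemma expectation_le_weaken: "expectation_le M f c \<Longrightarrow> c \<le> c' \<Longrightarrow> expectation_le M f c'"
  by (auto simp: expectation_le_def)

lemma expectation_le_imp_nonneg:
  assumes "expectation_le M f c" "\<And>x. 0 \<le> f x"
  shows "0 \<le> c"
  using assms Bochner_Integration.integral_nonneg[of M f] by (fastforce simp: expectation_le_def)

lemma expectation_le_iff_nn_integral:
  assumes "f \<in> borel_measurable M" "\<And>x. 0 \<le> f x" "0 \<le> c"
  shows "expectation_le M f c \<longleftrightarrow> (\<integral>\<^sup>+x. ennreal (f x) \<partial>M) \<le> ennreal c"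
proof
  assume "expectation_le M f c"
  then show "(\<integral>\<^sup>+x. ennreal (f x) \<partial>M) \<le> ennreal c"
    using assms by (auto simp: expectation_le_def nn_integral_eq_integral ennreal_leI)
next
  assume le: "(\<integral>\<^sup>+x. ennreal (f x) \<partial>M) \<le> ennreal c"
  then have int: "integrable M f"
    using assms by (intro integrableI_nonneg) (auto simp: le_less_trans)
  with le show "expectation_le M f c"
    using assms by (simp add: expectation_le_def nn_integral_eq_integral)
qed

lemma (in prob_space) expectation_le_affine:
  assumes f: "expectation_le M f c" and g: "g \<in> borel_measurable M"
    and bound: "\<And>x. x \<in> space M \<Longrightarrow> 0 \<le> g x \<and> g x \<le> \<alpha> * f x + \<beta>" and "0 \<le> \<alpha>"
  shows "expectation_le M g (\<alpha> * c + \<beta>)"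
proof -
  have int: "integrable M (\<lambda>x. \<alpha> * f x + \<beta>)"
    using f by (simp add: expectation_le_def)
  have int_g: "integrable M g"
    by (rule Bochner_Integration.integrable_bound[OF int g]) (use bound in \<open>force intro: AE_I2\<close>)
  have "(\<integral>x. g x \<partial>M) \<le> (\<integral>x. \<alpha> * f x + \<beta> \<partial>M)"
    using int_g int bound by (intro Bochner_Integration.integral_mono) auto
  also have "\<dots> = \<alpha> * (\<integral>x. f x \<partial>M) + \<beta>"
    using f by (simp add: expectation_le_def prob_space)
  also have "\<dots> \<le> \<alpha> * c + \<beta>"
    using f \<open>0 \<le> \<alpha>\<close> by (simp add: expectation_le_def mult_left_mono)
  finally show ?thesis
    using int_g by (simp add: expectation_le_def)
qed

lemma expectation_le_distr:
  assumes "g \<in> M \<rightarrow>\<^sub>M N" "f \<in> borel_measurable N"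
  shows "expectation_le (distr M N g) f c \<longleftrightarrow> expectation_le M (\<lambda>x. f (g x)) c"
  using assms by (simp add: expectation_le_def integrable_distr_eq integral_distr)

text \<open>
  The tower property: an affine bound on the conditional expectation integrates to the same affine
  bound on the expectation. Passing through nonnegative integrals gives integrability for free.
\<close>

lemma expectation_le_bind:
  assumes M: "M \<in> space (prob_algebra N)" and K: "K \<in> N \<rightarrow>\<^sub>M prob_algebra R"
    and f: "f \<in> borel_measurable R" "\<And>y. 0 \<le> f y"
    and g: "expectation_le M g c" "\<And>x. 0 \<le> g x"
    and step: "\<And>x. x \<in> space N \<Longrightarrow> expectation_le (K x) f (\<alpha> * g x + \<beta>)"
    and "0 \<le> \<alpha>" "0 \<le> \<beta>"
  shows "expectation_le (M \<bind> K) f (\<alpha> * c + \<beta>)"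
proof -
  have sets_M: "sets M = sets N" and "prob_space M"
    using M by (auto simp: space_prob_algebra)
  interpret prob_space M by fact
  have K': "K \<in> M \<rightarrow>\<^sub>M subprob_algebra R"
    using measurable_prob_algebraD[OF K] measurable_cong_sets[OF sets_M refl] by blast
  have c: "0 \<le> c"
    using g by (rule expectation_le_imp_nonneg)
  have affine: "expectation_le M (\<lambda>x. \<alpha> * g x + \<beta>) (\<alpha> * c + \<beta>)"
    using g assms(8,9) by (intro expectation_le_affine[OF g(1)]) (auto simp: expectation_le_def)
  have "(\<integral>\<^sup>+y. ennreal (f y) \<partial>(M \<bind> K)) = (\<integral>\<^sup>+x. \<integral>\<^sup>+y. ennreal (f y) \<partial>K x \<partial>M)"
    using f K' by (intro nn_integral_bind) auto
  also have "\<dots> \<le> (\<integral>\<^sup>+x. ennreal (\<alpha> * g x + \<beta>) \<partial>M)"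
  proof (rule nn_integral_mono)
    fix x assume "x \<in> space M"
    then have x: "x \<in> space N"
      using sets_eq_imp_space_eq[OF sets_M] by simp
    have "f \<in> borel_measurable (K x)"
      using f(1) measurable_space[OF K x] measurable_cong_sets[OF _ refl]
      by (auto simp: space_prob_algebra)
    then show "(\<integral>\<^sup>+y. ennreal (f y) \<partial>K x) \<le> ennreal (\<alpha> * g x + \<beta>)"
      using step[OF x] expectation_le_iff_nn_integral[of f "K x"] f(2) g(2) assms(8,9) by simp
  qed
  also have "\<dots> \<le> ennreal (\<alpha> * c + \<beta>)"
    using affine g(2) c assms(8,9)
    by (intro expectation_le_iff_nn_integral[THEN iffD1]) (auto simp: expectation_le_def)
  finally show ?thesis
    using f c assms(8,9) sets_bind'[OF M K]
    by (subst expectation_le_iff_nn_integral) (auto cong: measurable_cong_sets)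
qed

section \<open>The error recursion\<close>

text \<open>
  With \<open>Q\<close> for the transient part of the error and \<open>w = \<kappa> u\<close>, the step maps \<open>C w + Q\<close> to a value that
  is again below \<open>C w\<close> plus a transient contracted by \<open>(1 + C u) q\<close>. The stationary part satisfies
  \<open>(1 + u) q \<cdot> C w \<le> C w / 2\<close>, which leaves \<open>C w / 2 = (40 n + 40) w\<close> for everything of order \<open>w\<close>.
  These terms come to at most \<open>(22.5 n + 1) w\<close>, using \<open>C w \<le> 3 / 4\<close> and \<open>Q \<le> 1 / 2\<close>.
\<close>

lemma error_recursion_stable:
  fixes n u \<kappa> q C Q :: real
  assumes C: "C = 80 * n + 80" and n: "1 \<le> n" and u: "0 < u" and \<kappa>: "1 \<le> \<kappa>"
    and cond: "C * \<kappa> * u < 3 / 4" and q: "0 \<le> q" "(1 + C * u) * q < 1 / 2"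
    and Q: "0 \<le> Q" "Q \<le> 1 / 2"
  shows "((1 + u) * q + (1 + u) * (1 + q) * (5 * n * \<kappa> * u)) * (C * \<kappa> * u + Q)
      + ((1 + u) * (1 + q) * (5 * n * \<kappa> * u) + u)
    \<le> C * \<kappa> * u + (1 + C * u) * q * Q"
proof -
  define w where "w = \<kappa> * u"
  have w: "0 < w" "u \<le> w"
    using u \<kappa> mult_right_mono[of 1 \<kappa> u] by (auto simp: w_def)
  define K where "K = C * w"
  have K: "0 \<le> K" "K \<le> 3 / 4"
    using cond C n w by (auto simp: K_def w_def mult.assoc)
  have "160 * w \<le> K"
    unfolding K_def using C n w by (intro mult_right_mono) auto
  then have u1: "u \<le> 1 / 80"
    using w K by linarith
  have q_le: "(1 + u) * q \<le> (1 + C * u) * q"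
    using C n u q(1) mult_right_mono[of 1 C u] by (intro mult_right_mono) auto
  have "1 * q \<le> (1 + u) * q"
    using u q(1) by (intro mult_right_mono) auto
  then have q1: "q \<le> 1 / 2"
    using q_le q by linarith
  have "(1 + u) * (1 + q) \<le> (1 + 1 / 80) * (1 + 1 / 2)"
    using u1 q1 u q by (intro mult_mono) auto
  then have "(1 + u) * (1 + q) * (5 * n * w) \<le> 2 * (5 * n * w)"
    using n w by (intro mult_right_mono) auto
  \<comment> \<open>A name for the product lets linear arithmetic treat it as an atom.\<close>
  then obtain h where h: "h = (1 + u) * (1 + q) * (5 * n * w)" "h \<le> 10 * n * w"
    by simp
  have nw: "0 \<le> n * w"
    using n w by simp
  have "(1 + u) * q * K \<le> 1 / 2 * K"
    using K q_le q by (intro mult_right_mono) auto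
  moreover have "(1 + u) * q * Q \<le> (1 + C * u) * q * Q"
    using q_le Q(1) by (rule mult_right_mono)
  moreover have "h * (K + Q) \<le> 10 * n * w * (3 / 4 + 1 / 2)"
    using h K Q nw by (intro mult_mono) auto
  moreover have "K = 80 * (n * w) + 80 * w"
    by (simp add: K_def C algebra_simps)
  ultimately have "((1 + u) * q + h) * (K + Q) + (h + u) \<le> K + (1 + C * u) * q * Q"
    using h(2) nw w by (simp add: algebra_simps)
  then show ?thesis
    by (simp add: h(1) K_def w_def mult.assoc)
qed

lemma half_power_ceiling_log_le:
  fixes w :: real
  assumes "0 < w"
  shows "(1 / 2) ^ nat \<lceil>log 2 (1 / w)\<rceil> \<le> w"
proof -
  let ?t = "nat \<lceil>log 2 (1 / w)\<rceil>"
  have "log 2 (1 / w) \<le> real ?t"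
    by linarith
  then have "1 / w \<le> 2 powr real ?t"
    using assms by (simp add: log_le_iff)
  then show ?thesis
    using assms by (simp add: powr_realpow field_simps)
qed

lemma dim_polynomial_affine: "dim_polynomial (\<lambda>m n. a * real n + c)"
  unfolding dim_polynomial_def
  by (rule exI[of _ 1], rule exI[of _ "\<lambda>i j. if i = 0 then if j = 0 then c else a else 0"]) simp

text \<open>
  The transient at least halves in each step, and the number of steps is chosen so that \<open>2\<^sup>-\<^sup>t \<le> w\<close>.
\<close>

lemma transient_error_le:
  fixes q u C w :: real
  assumes q: "0 \<le> q" "(1 + C * u) * q < 1 / 2" and Cu: "0 \<le> C * u" and w: "0 < w"
    and t: "t = nat \<lceil>log 2 (1 / w)\<rceil>"
  shows "(1 + C * u) ^ t * q ^ (t + 1) \<le> w"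
proof -
  have "1 * q \<le> (1 + C * u) * q"
    using q Cu by (intro mult_right_mono) auto
  then have "q \<le> 1"
    using q by linarith
  have "(1 + C * u) ^ t * q ^ (t + 1) = ((1 + C * u) * q) ^ t * q"
    by (simp add: power_mult_distrib)
  also have "\<dots> \<le> (1 / 2) ^ t * 1"
    using q Cu \<open>q \<le> 1\<close> by (intro mult_mono power_mono) auto
  also have "\<dots> \<le> w"
    using half_power_ceiling_log_le[OF w] by (simp add: t)
  finally show ?thesis .
qed

context standard_fp_model
begin

text \<open>
  A negative accuracy would force the solution to vanish for every representable right-hand side, but
  the columns of \<open>A\<close> are representable and have the unit vectors as solutions.
\<close>

lemma solver_accuracy_nonneg:
  assumes A: "A \<in> carrier_mat m n" "elements_mat A \<subseteq> F" "full_column_rank A" and n: "0 < n"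
    and accurate: "\<And>c. c \<in> fp_vecs F m \<Longrightarrow>
      expectation_le (S c) (\<lambda>y. vnorm (y - pinv A *\<^sub>v c)) (q * vnorm (pinv A *\<^sub>v c))"
  shows "0 \<le> q"
proof -
  have "col A 0 \<in> fp_vecs F m"
    using A n by (auto simp: fp_vecs_def elements_mat_subset_index)
  from expectation_le_imp_nonneg[OF accurate[OF this]] show ?thesis
    using pinv_mult_col[OF A(1,3) n] vnorm_unit_vec[OF n] by simp
qed

text \<open>
  One step of the recursion, conditionally on the current iterate \<open>y\<close>. The computed residual is a
  representable vector, so the solver's guarantee applies to it as it stands; the exact solution for it
  has norm at most \<open>\<parallel>y - x\<parallel>\<close> up to the error of the residual.
\<close>

lemma refinement_kernel_error:
  assumes A: "A \<in> carrier_mat m n" "elements_mat A \<subseteq> F" "full_column_rank A"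
    and S: "randomized_subroutine F m n S"
    and accurate: "\<And>c. c \<in> fp_vecs F m \<Longrightarrow>
      expectation_le (S c) (\<lambda>y. vnorm (y - pinv A *\<^sub>v c)) (q * vnorm (pinv A *\<^sub>v c))"
    and x: "x \<in> carrier_vec n" and b: "A *\<^sub>v x \<in> fp_vecs F m"
    and y: "y \<in> fp_vecs F n" and n: "0 < n" and nu: "real n * u \<le> 1" and q: "0 \<le> q"
  defines "\<epsilon> \<equiv> 5 * real n * demmel_cond A * u"
  shows "expectation_le
    (distr (S (fp_residual fop A (A *\<^sub>v x) y)) (fp_space F n) (fp_vec_op fop Add y))
    (\<lambda>z. vnorm (z - x))
    (((1 + u) * q + (1 + u) * (1 + q) * \<epsilon>) * vnorm (y - x)
      + ((1 + u) * (1 + q) * \<epsilon> + u) * vnorm x)"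
proof -
  define r where "r = fp_residual fop A (A *\<^sub>v x) y"
  define z where "z = pinv A *\<^sub>v r"
  have r: "r \<in> fp_vecs F m"
    unfolding r_def by (rule fp_residual_fp_vecs[OF A(1,2) b y])
  have cy: "y \<in> carrier_vec n" and z: "z \<in> carrier_vec n"
    using y r pinv_full_column_rank(1)[OF A(1,3)] by (auto simp: z_def fp_vecs_carrier)
  have S_r: "S r \<in> space (prob_algebra (fp_space F n))"
    using measurable_space[OF S[unfolded randomized_subroutine_def]] r by simp
  then interpret prob_space "S r"
    by (simp add: space_prob_algebra)
  have sets_S: "sets (S r) = sets (fp_space F n)"
    using S_r by (simp add: space_prob_algebra)
  have add: "fp_vec_op fop Add y \<in> S r \<rightarrow>\<^sub>M fp_space F n"
    using measurable_compose_Pair1[OF _ fp_add_measurable, of y n] y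
    by (simp add: measurable_cong_sets[OF sets_S refl])
  have norm: "(\<lambda>z. vnorm (z - x)) \<in> borel_measurable (fp_space F n)"
    by (rule measurable_fp_space_vnorm_diff[OF x])
  have raw: "expectation_le (S r) (\<lambda>d. vnorm (fp_vec_op fop Add y d - x))
      ((1 + u) * (q * vnorm z) + ((1 + u) * vnorm (z - (x - y)) + u * vnorm x))"
  proof (rule expectation_le_affine[OF accurate[OF r, folded z_def]])
    fix d assume "d \<in> space (S r)"
    then have "d \<in> fp_vecs F n"
      using sets_eq_imp_space_eq[OF sets_S] by simp
    from refinement_step_error[OF A x b y this]
    show "0 \<le> vnorm (fp_vec_op fop Add y d - x) \<and>
      vnorm (fp_vec_op fop Add y d - x)
        \<le> (1 + u) * vnorm (d - z) + ((1 + u) * vnorm (z - (x - y)) + u * vnorm x)"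
      by (simp add: z_def r_def)
  qed (use u_pos measurable_compose[OF add norm] in auto)
  have residual: "vnorm (z - (x - y)) \<le> \<epsilon> * (vnorm (y - x) + vnorm x)"
    unfolding z_def r_def \<epsilon>_def by (rule pinv_fp_residual_error[OF A x b y n nu])
  have "z = (z - (x - y)) + (x - y)"
    by (rule eq_vecI) (use z x cy in auto)
  then have "vnorm z \<le> vnorm (y - x) + vnorm (z - (x - y))"
    using vnorm_add_le[of "z - (x - y)" n "x - y"] z x cy vnorm_minus_commute[of x n y] by simp
  then have "vnorm z \<le> vnorm (y - x) + \<epsilon> * (vnorm (y - x) + vnorm x)"
    using residual by linarith
  then have "(1 + u) * (q * vnorm z) + ((1 + u) * vnorm (z - (x - y)) + u * vnorm x)
    \<le> (1 + u) * (q * (vnorm (y - x) + \<epsilon> * (vnorm (y - x) + vnorm x)))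
      + ((1 + u) * (\<epsilon> * (vnorm (y - x) + vnorm x)) + u * vnorm x)"
    using residual u_pos q by (intro add_mono mult_left_mono) auto
  also have "\<dots> = ((1 + u) * q + (1 + u) * (1 + q) * \<epsilon>) * vnorm (y - x)
      + ((1 + u) * (1 + q) * \<epsilon> + u) * vnorm x"
    by (simp add: algebra_simps)
  finally show ?thesis
    using expectation_le_weaken[OF raw] expectation_le_distr[OF add norm] by (simp add: r_def)
qed

lemma iterative_refinement_error:
  assumes A: "A \<in> carrier_mat m n" "elements_mat A \<subseteq> F" "full_column_rank A"
    and S: "randomized_subroutine F m n S"
    and accurate: "\<And>c. c \<in> fp_vecs F m \<Longrightarrow>
      expectation_le (S c) (\<lambda>y. vnorm (y - pinv A *\<^sub>v c)) (q * vnorm (pinv A *\<^sub>v c))"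
    and x: "x \<in> carrier_vec n" and b: "A *\<^sub>v x \<in> fp_vecs F m"
    and n: "0 < n" and C: "C = 80 * real n + 80"
    and q: "(1 + C * u) * q < 1 / 2" and cond: "C * demmel_cond A * u < 3 / 4"
  shows "expectation_le (refinement_law F fop A (A *\<^sub>v x) S t) (\<lambda>y. vnorm (y - x))
    ((C * demmel_cond A * u + (1 + C * u) ^ t * q ^ (t + 1)) * vnorm x)"
proof (induction t)
  have \<kappa>: "1 \<le> demmel_cond A"
    by (rule demmel_cond_ge_1[OF A(1,3) n])
  have q0: "0 \<le> q"
    by (rule solver_accuracy_nonneg[OF A n accurate])
  \<comment> \<open>Since \<open>\<kappa> \<ge> 1\<close>, the conditioning hypothesis also bounds \<open>C u\<close>, and so makes \<open>n u\<close> small.\<close>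
  have "C * u * 1 \<le> C * u * demmel_cond A"
    using C u_pos \<kappa> by (intro mult_left_mono) auto
  moreover have "real n * u \<le> C * u"
    using C u_pos by (intro mult_right_mono) auto
  ultimately have nu: "real n * u \<le> 1"
    using cond by (simp add: mult_ac)
  have growth: "1 \<le> 1 + C * u"
    using C u_pos by simp
  {
    case 0
    have "q * vnorm x \<le> (C * demmel_cond A * u + (1 + C * u) ^ 0 * q ^ (0 + 1)) * vnorm x"
      using C u_pos \<kappa> by (intro mult_right_mono) auto
    then show ?case
      using accurate[OF b] pinv_mult_mat_vec[OF A(1,3) x] by (auto intro: expectation_le_weaken)
  next
    case (Suc t)
    define \<epsilon> where "\<epsilon> = 5 * real n * demmel_cond A * u"
    define \<alpha> where "\<alpha> = (1 + u) * q + (1 + u) * (1 + q) * \<epsilon>"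
    define \<beta> where "\<beta> = (1 + u) * (1 + q) * \<epsilon> + u"
    define Q where "Q = (1 + C * u) ^ t * q ^ (t + 1)"
    have nonneg: "0 \<le> \<alpha>" "0 \<le> \<beta>"
      using u_pos q0 \<kappa> by (auto simp: \<alpha>_def \<beta>_def \<epsilon>_def)
    have Q0: "0 \<le> Q"
      using growth q0 by (simp add: Q_def)
    have "Q = ((1 + C * u) * q) ^ t * q"
      by (simp add: Q_def power_mult_distrib)
    also have "\<dots> \<le> 1 * q"
      using growth q q0 by (intro mult_right_mono power_le_one) auto
    also have "\<dots> \<le> (1 + C * u) * q"
      using growth q0 by (intro mult_right_mono) auto
    finally have Q1: "Q \<le> 1 / 2"
      using q by linarith
    have "expectation_le (refinement_law F fop A (A *\<^sub>v x) S (Suc t)) (\<lambda>y. vnorm (y - x))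
        (\<alpha> * ((C * demmel_cond A * u + Q) * vnorm x) + \<beta> * vnorm x)"
      unfolding refinement_law.simps carrier_matD(2)[OF A(1)]
    proof (rule expectation_le_bind)
      show "refinement_law F fop A (A *\<^sub>v x) S t \<in> space (prob_algebra (fp_space F n))"
        by (rule refinement_law_space[OF A(1,2) b S])
      show "(\<lambda>y. distr (S (fp_residual fop A (A *\<^sub>v x) y)) (fp_space F n) (\<lambda>d. fp_vec_op fop Add y d))
          \<in> fp_space F n \<rightarrow>\<^sub>M prob_algebra (fp_space F n)"
        by (rule refinement_kernel_measurable[OF A(1,2) b S])
      show "(\<lambda>y. vnorm (y - x)) \<in> borel_measurable (fp_space F n)"
        by (rule measurable_fp_space_vnorm_diff[OF x])
      show "expectation_le (refinement_law F fop A (A *\<^sub>v x) S t) (\<lambda>y. vnorm (y - x))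
          ((C * demmel_cond A * u + Q) * vnorm x)"
        using Suc.IH by (simp add: Q_def)
      show "expectation_le (distr (S (fp_residual fop A (A *\<^sub>v x) y)) (fp_space F n) (\<lambda>d. fp_vec_op fop Add y d))
          (\<lambda>z. vnorm (z - x)) (\<alpha> * vnorm (y - x) + \<beta> * vnorm x)"
        if "y \<in> space (fp_space F n)" for y
        unfolding \<alpha>_def \<beta>_def \<epsilon>_def
        using refinement_kernel_error[OF A S accurate x b _ n nu q0, of y] that by simp
    qed (use nonneg in auto)
    moreover have "\<alpha> * ((C * demmel_cond A * u + Q) * vnorm x) + \<beta> * vnorm x
        \<le> (C * demmel_cond A * u + (1 + C * u) ^ Suc t * q ^ (Suc t + 1)) * vnorm x"
    proof -
      have "\<alpha> * (C * demmel_cond A * u + Q) + \<beta> \<le> C * demmel_cond A * u + (1 + C * u) * q * Q"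
        unfolding \<alpha>_def \<beta>_def \<epsilon>_def
        by (rule error_recursion_stable[OF C _ u_pos \<kappa> cond q0 q Q0 Q1]) (use n in simp)
      also have "(1 + C * u) * q * Q = (1 + C * u) ^ Suc t * q ^ (Suc t + 1)"
        by (simp add: Q_def)
      finally have "(\<alpha> * (C * demmel_cond A * u + Q) + \<beta>) * vnorm x
          \<le> (C * demmel_cond A * u + (1 + C * u) ^ Suc t * q ^ (Suc t + 1)) * vnorm x"
        by (rule mult_right_mono) simp
      then show ?thesis
        by (simp add: distrib_right mult.assoc)
    qed
    ultimately show ?case
      by (rule expectation_le_weaken)
  }
qed

end

theorem theorem3p1:
  shows "\<exists>C C' :: nat \<Rightarrow> nat \<Rightarrow> real.
    dim_polynomial C \<and> dim_polynomial C' \<and> (\<forall>m n. 0 < C m n) \<and> (\<forall>m n. 0 < C' m n) \<and>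
    (\<forall>(m::nat) (n::nat) (u::real) (F :: real set) fl fop (A :: real Matrix.mat) (b :: real Matrix.vec)
        (Solver :: real Matrix.vec \<Rightarrow> real Matrix.vec measure) (q::real).
      standard_fp_model u F fl fop \<longrightarrow>
      A \<in> carrier_mat m n \<longrightarrow> full_column_rank A \<longrightarrow>
      elements_mat A \<subseteq> F \<longrightarrow> b \<in> fp_vecs F m \<longrightarrow>
      randomized_subroutine F m n Solver \<longrightarrow>
      (\<forall>c \<in> fp_vecs F m.
         expectation_le (Solver c) (\<lambda>y. vnorm (y - pinv A *\<^sub>v c)) (q * vnorm (pinv A *\<^sub>v c))) \<longrightarrow>
      (1 + C m n * u) * q < 1 / 2 \<longrightarrow>
      C m n * demmel_cond A * u < 3 / 4 \<longrightarrow>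
      b \<in> mat_range A \<longrightarrow>
      (\<forall>t::nat. expectation_le (refinement_law F fop A b Solver t)
         (\<lambda>x. vnorm (x - pinv A *\<^sub>v b))
         ((C m n * demmel_cond A * u + (1 + C m n * u) ^ t * q ^ (t + 1)) * vnorm (pinv A *\<^sub>v b))) \<and>
      expectation_le
         (refinement_law F fop A b Solver (nat \<lceil>log 2 (1 / (demmel_cond A * u))\<rceil>))
         (\<lambda>x. vnorm (x - pinv A *\<^sub>v b))
         (C' m n * (demmel_cond A * u * vnorm (pinv A *\<^sub>v b))))"
proof (intro exI conjI allI impI)
  let ?C = "\<lambda>m n :: nat. 80 * real n + 80"
  \<comment> \<open>The extra \<open>1\<close> pays for the transient, which is at most \<open>\<kappa> u\<close> after the stated number of steps.\<close>
  let ?C' = "\<lambda>m n :: nat. 80 * real n + 81"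
  show "dim_polynomial ?C" "dim_polynomial ?C'"
    by (rule dim_polynomial_affine)+
  show "0 < ?C m n" "0 < ?C' m n" for m n
    by auto
  fix m n :: nat and u :: real and F fl fop and A :: "real Matrix.mat" and b :: "real Matrix.vec"
    and Solver :: "real Matrix.vec \<Rightarrow> real Matrix.vec measure" and q :: real
  assume fp: "standard_fp_model u F fl fop"
    and A: "A \<in> carrier_mat m n" and rank: "full_column_rank A" and repr: "elements_mat A \<subseteq> F"
    and b: "b \<in> fp_vecs F m" and S: "randomized_subroutine F m n Solver"
    and accurate: "\<forall>c \<in> fp_vecs F m.
      expectation_le (Solver c) (\<lambda>y. vnorm (y - pinv A *\<^sub>v c)) (q * vnorm (pinv A *\<^sub>v c))"
    and q: "(1 + ?C m n * u) * q < 1 / 2" and cond: "?C m n * demmel_cond A * u < 3 / 4"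
    and range: "b \<in> mat_range A"
  interpret standard_fp_model u F fl fop
    by fact
  obtain x where x: "x \<in> carrier_vec n" and b_eq: "b = A *\<^sub>v x"
    using range A by (auto simp: mat_range_def)
  have sol: "pinv A *\<^sub>v b = x"
    using pinv_mult_mat_vec[OF A rank x] by (simp add: b_eq)
  show limit: "expectation_le (refinement_law F fop A b Solver t) (\<lambda>y. vnorm (y - pinv A *\<^sub>v b))
      ((?C m n * demmel_cond A * u + (1 + ?C m n * u) ^ t * q ^ (t + 1)) * vnorm (pinv A *\<^sub>v b))"
    for t
  proof (cases "n = 0")
    case True
    then have "vnorm x = 0" "\<And>y. vnorm (y - x) = 0"
      using x by (auto simp: vnorm_def)
    then show ?thesis
      by (simp add: sol expectation_le_def)
  next
    case False
    then show ?thesis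
      unfolding sol unfolding b_eq
      using iterative_refinement_error[OF A repr rank S _ x _ _ refl q cond] accurate b
      by (simp add: b_eq)
  qed
  let ?t = "nat \<lceil>log 2 (1 / (demmel_cond A * u))\<rceil>"
  have "(?C m n * demmel_cond A * u + (1 + ?C m n * u) ^ ?t * q ^ (?t + 1)) * vnorm x
      \<le> ?C' m n * (demmel_cond A * u * vnorm x)"
  proof (cases "n = 0")
    case True
    then show ?thesis
      using x by (simp add: vnorm_def)
  next
    case False
    then have "0 < n"
      by simp
    have "0 \<le> q"
      using solver_accuracy_nonneg[OF A repr rank \<open>0 < n\<close>] accurate by blast
    moreover have "0 < demmel_cond A * u"
      using demmel_cond_ge_1[OF A rank \<open>0 < n\<close>] u_pos by simp
    ultimately have "(1 + ?C m n * u) ^ ?t * q ^ (?t + 1) \<le> demmel_cond A * u"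
      using q u_pos by (intro transient_error_le) auto
    then have "(?C m n * demmel_cond A * u + (1 + ?C m n * u) ^ ?t * q ^ (?t + 1)) * vnorm x
        \<le> (?C m n * demmel_cond A * u + demmel_cond A * u) * vnorm x"
      by (intro mult_right_mono add_left_mono) auto
    also have "\<dots> = ?C' m n * (demmel_cond A * u * vnorm x)"
      by (simp add: algebra_simps)
    finally show ?thesis .
  qed
  then show "expectation_le (refinement_law F fop A b Solver ?t) (\<lambda>y. vnorm (y - pinv A *\<^sub>v b))
      (?C' m n * (demmel_cond A * u * vnorm (pinv A *\<^sub>v b)))"
    using expectation_le_weaken[OF limit[of ?t]] by (simp add: sol)
qed

end
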